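(* The following are equivalent for any residuated lattice $A$: (1) $A$ has the Boolean Lifting Property (BLP); (2) for all $x\in A$, there exists $e\in\mathcal{B}(A)$ such that $e\in[x)$ and $\neg e\in[\neg x)$; (3) for all $x,y\in A$ such that $x\odot y=0$, there exists $e\in\mathcal{B}(A)$ such that $e\in[x)$ and $\neg e\in[y)$; (4) given any natural number $n\geq 2$, for all $x_1,\ldots,x_n\in A$ such that $x_1\odot\cdots\odot x_n=0$, there exist $e_1,\ldots,e_n\in\mathcal{B}(A)$ such that $\bigwedge_{i=1}^n e_i=0$, $e_i\vee e_j=1$ for all $i,j\in\{1,\ldots,n\}$ with $i\neq j$, and $e_i\in[x_i)$ for all $i\in\{1,\ldots,n\}$.
   Context: A residuated lattice is an algebra $(A,\vee,\wedge,\odot,\rightarrow,0,1)$ such that $(A,\vee,\wedge,0,1)$ is a bounded lattice (with order $\leq$), $(A,\odot,1)$ is a commutative monoid, and $a\leq b\rightarrow c$ iff $a\odot b\leq c$ for all $a,b,c$. Put $a\leftrightarrow b=(a\rightarrow b)\wedge(b\rightarrow a)$ and $\neg a=a\rightarrow 0$; $a^n$ is the $n$-fold $\odot$-power. $\mathcal{B}(A)$ is the set of complemented elements of the bounded lattice $(A,\vee,\wedge,0,1)$; it is a Boolean algebra with complement $\neg$. A filter of $A$ is a non-empty subset closed under $\odot$ and upward closed. $[x)=\{a\in A\mid x^n\leq a\text{ for some integer }n\geq 1\}$ is the filter generated by $x$. For a filter $F$, $x\equiv y\ (\mathrm{mod}\ F)$ iff $x\leftrightarrow y\in F$ is a congruence;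 $A/F$ is the quotient residuated lattice, $x/F$ the class of $x$, $\mathcal{B}(A)/F=\{e/F\mid e\in\mathcal{B}(A)\}$. A filter $F$ has BLP iff $\mathcal{B}(A/F)=\mathcal{B}(A)/F$; $A$ has BLP iff every filter of $A$ has BLP. *)

theory Defs
  imports "HOL-Algebra.FiniteProduct"
begin

record 'a rlattice = "'a monoid" +
  zero :: 'a (\<open>\<zero>\<index>\<close>)
  ljoin :: "['a, 'a] \<Rightarrow> 'a" (infixl \<open>\<curlyvee>\<index>\<close> 65)
  lmeet :: "['a, 'a] \<Rightarrow> 'a" (infixl \<open>\<curlywedge>\<index>\<close> 67)
  resid :: "['a, 'a] \<Rightarrow> 'a" (infixr \<open>\<leadsto>\<index>\<close> 60)

definition rl_le :: "('a, 'm) rlattice_scheme \<Rightarrow> 'a \<Rightarrow> 'a \<Rightarrow> bool" (infix \<open>\<preceq>\<index>\<close> 50)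
  where "x \<preceq>\<^bsub>A\<^esub> y \<longleftrightarrow> x \<curlywedge>\<^bsub>A\<^esub> y = x"

text \<open>The field \<open>one\<close> inherited from \<open>monoid\<close> is at the same time the unit of \<open>mult\<close> and the
  greatest element of the lattice. The trivial algebra (\<open>\<zero> = \<one>\<close>) is not excluded.\<close>

locale residuated_lattice = comm_monoid A for A (structure) +
  assumes zero_closed [intro, simp]: "\<zero> \<in> carrier A"
    and join_closed [intro, simp]:
      "\<lbrakk>x \<in> carrier A; y \<in> carrier A\<rbrakk> \<Longrightarrow> x \<curlyvee> y \<in> carrier A"
    and meet_closed [intro, simp]:
      "\<lbrakk>x \<in> carrier A; y \<in> carrier A\<rbrakk> \<Longrightarrow> x \<curlywedge> y \<in> carrier A"
    and resid_closed [intro, simp]: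
      "\<lbrakk>x \<in> carrier A; y \<in> carrier A\<rbrakk> \<Longrightarrow> x \<leadsto> y \<in> carrier A"
    and join_assoc: "\<lbrakk>x \<in> carrier A; y \<in> carrier A; z \<in> carrier A\<rbrakk>
      \<Longrightarrow> (x \<curlyvee> y) \<curlyvee> z = x \<curlyvee> (y \<curlyvee> z)"
    and meet_assoc: "\<lbrakk>x \<in> carrier A; y \<in> carrier A; z \<in> carrier A\<rbrakk>
      \<Longrightarrow> (x \<curlywedge> y) \<curlywedge> z = x \<curlywedge> (y \<curlywedge> z)"
    and join_comm: "\<lbrakk>x \<in> carrier A; y \<in> carrier A\<rbrakk> \<Longrightarrow> x \<curlyvee> y = y \<curlyvee> x"
    and meet_comm: "\<lbrakk>x \<in> carrier A; y \<in> carrier A\<rbrakk> \<Longrightarrow> x \<curlywedge> y = y \<curlywedge> x"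
    and join_absorb: "\<lbrakk>x \<in> carrier A; y \<in> carrier A\<rbrakk> \<Longrightarrow> x \<curlyvee> (x \<curlywedge> y) = x"
    and meet_absorb: "\<lbrakk>x \<in> carrier A; y \<in> carrier A\<rbrakk> \<Longrightarrow> x \<curlywedge> (x \<curlyvee> y) = x"
    and zero_least: "x \<in> carrier A \<Longrightarrow> \<zero> \<preceq> x"
    and one_greatest: "x \<in> carrier A \<Longrightarrow> x \<preceq> \<one>"
    and residuation: "\<lbrakk>x \<in> carrier A; y \<in> carrier A; z \<in> carrier A\<rbrakk>
      \<Longrightarrow> x \<preceq> y \<leadsto> z \<longleftrightarrow> x \<otimes> y \<preceq> z"

definition rl_bires :: "('a, 'm) rlattice_scheme \<Rightarrow> 'a \<Rightarrow> 'a \<Rightarrow> 'a"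
  where "rl_bires A x y = (x \<leadsto>\<^bsub>A\<^esub> y) \<curlywedge>\<^bsub>A\<^esub> (y \<leadsto>\<^bsub>A\<^esub> x)"

definition rl_neg :: "('a, 'm) rlattice_scheme \<Rightarrow> 'a \<Rightarrow> 'a"
  where "rl_neg A x = x \<leadsto>\<^bsub>A\<^esub> \<zero>\<^bsub>A\<^esub>"

definition boolean_center :: "('a, 'm) rlattice_scheme \<Rightarrow> 'a set"
  where "boolean_center A = {e \<in> carrier A.
    \<exists>f \<in> carrier A. e \<curlyvee>\<^bsub>A\<^esub> f = \<one>\<^bsub>A\<^esub> \<and> e \<curlywedge>\<^bsub>A\<^esub> f = \<zero>\<^bsub>A\<^esub>}"

text \<open>The whole carrier counts as a filter.\<close>

definition rl_filter :: "('a, 'm) rlattice_scheme \<Rightarrow> 'a set \<Rightarrow> bool"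
  where "rl_filter A F \<longleftrightarrow> F \<subseteq> carrier A \<and> F \<noteq> {} \<and>
    (\<forall>x\<in>F. \<forall>y\<in>F. x \<otimes>\<^bsub>A\<^esub> y \<in> F) \<and>
    (\<forall>x\<in>F. \<forall>y\<in>carrier A. x \<preceq>\<^bsub>A\<^esub> y \<longrightarrow> y \<in> F)"

definition principal_filter :: "('a, 'm) rlattice_scheme \<Rightarrow> 'a \<Rightarrow> 'a set"
  where "principal_filter A x = {a \<in> carrier A. \<exists>n::nat. n \<ge> 1 \<and> x [^]\<^bsub>A\<^esub> n \<preceq>\<^bsub>A\<^esub> a}"

definition rl_cong :: "('a, 'm) rlattice_scheme \<Rightarrow> 'a set \<Rightarrow> ('a \<times> 'a) set"
  where "rl_cong A F = {(x, y). x \<in> carrier A \<and> y \<in> carrier A \<and> rl_bires A x y \<in> F}"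

definition rl_class :: "('a, 'm) rlattice_scheme \<Rightarrow> 'a set \<Rightarrow> 'a \<Rightarrow> 'a set"
  where "rl_class A F x = rl_cong A F `` {x}"

text \<open>An operation of the quotient sends two classes to the union of the classes of all values on
  representatives. As \<open>rl_cong A F\<close> is a congruence, that union is a single class; see
  \<open>quot_class_simps\<close> and \<open>residuated_lattice_quot\<close> below.\<close>

definition lift_op ::
    "('a, 'm) rlattice_scheme \<Rightarrow> 'a set \<Rightarrow> ('a \<Rightarrow> 'a \<Rightarrow> 'a) \<Rightarrow> 'a set \<Rightarrow> 'a set \<Rightarrow> 'a set"
  where "lift_op A F f X Y = (\<Union>x\<in>X. \<Union>y\<in>Y. rl_class A F (f x y))"

definition rl_quot :: "('a, 'm) rlattice_scheme \<Rightarrow> 'a set \<Rightarrow> 'a set rlattice"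
  where "rl_quot A F =
    \<lparr>carrier = carrier A // rl_cong A F,
     mult = lift_op A F (mult A),
     one = rl_class A F \<one>\<^bsub>A\<^esub>,
     zero = rl_class A F \<zero>\<^bsub>A\<^esub>,
     ljoin = lift_op A F (ljoin A),
     lmeet = lift_op A F (lmeet A),
     resid = lift_op A F (resid A)\<rparr>"

definition filter_BLP :: "('a, 'm) rlattice_scheme \<Rightarrow> 'a set \<Rightarrow> bool"
  where "filter_BLP A F \<longleftrightarrow> boolean_center (rl_quot A F) = rl_class A F ` boolean_center A"

definition BLP :: "('a, 'm) rlattice_scheme \<Rightarrow> bool"
  where "BLP A \<longleftrightarrow> (\<forall>F. rl_filter A F \<longrightarrow> filter_BLP A F)"

text \<open>Iterated meet over a finite index set, as the finite product of the commutative monoid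
  \<open>(A, \<and>, 1)\<close>.\<close>

definition finmeet :: "('a, 'm) rlattice_scheme \<Rightarrow> ('i \<Rightarrow> 'a) \<Rightarrow> 'i set \<Rightarrow> 'a"
  where "finmeet A e I =
    finprod \<lparr>carrier = carrier A, mult = lmeet A, one = \<one>\<^bsub>A\<^esub>\<rparr> e I"

context residuated_lattice
begin

lemma meet_idem: "x \<in> carrier A \<Longrightarrow> x \<curlywedge> x = x"
  by (metis join_absorb join_closed meet_absorb)

lemma le_refl [simp]: "x \<in> carrier A \<Longrightarrow> x \<preceq> x"
  by (simp add: rl_le_def meet_idem)

lemma le_trans:
  "\<lbrakk>x \<preceq> y; y \<preceq> z; x \<in> carrier A; y \<in> carrier A; z \<in> carrier A\<rbrakk> \<Longrightarrow> x \<preceq> z"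
  unfolding rl_le_def by (metis meet_assoc)

lemma le_antisym: "\<lbrakk>x \<preceq> y; y \<preceq> x; x \<in> carrier A; y \<in> carrier A\<rbrakk> \<Longrightarrow> x = y"
  unfolding rl_le_def by (metis meet_comm)

lemma le_iff_join: "\<lbrakk>x \<in> carrier A; y \<in> carrier A\<rbrakk> \<Longrightarrow> x \<preceq> y \<longleftrightarrow> x \<curlyvee> y = y"
  unfolding rl_le_def by (metis join_absorb join_comm meet_absorb meet_comm)

lemma meet_le1: "\<lbrakk>x \<in> carrier A; y \<in> carrier A\<rbrakk> \<Longrightarrow> x \<curlywedge> y \<preceq> x"
  unfolding rl_le_def by (metis meet_assoc meet_comm meet_idem)

lemma meet_le2: "\<lbrakk>x \<in> carrier A; y \<in> carrier A\<rbrakk> \<Longrightarrow> x \<curlywedge> y \<preceq> y"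
  by (metis meet_comm meet_le1)

lemma meet_greatest:
  "\<lbrakk>z \<preceq> x; z \<preceq> y; x \<in> carrier A; y \<in> carrier A; z \<in> carrier A\<rbrakk> \<Longrightarrow> z \<preceq> x \<curlywedge> y"
  unfolding rl_le_def by (metis meet_assoc)

lemma join_ge1: "\<lbrakk>x \<in> carrier A; y \<in> carrier A\<rbrakk> \<Longrightarrow> x \<preceq> x \<curlyvee> y"
  by (simp add: rl_le_def meet_absorb)

lemma join_ge2: "\<lbrakk>x \<in> carrier A; y \<in> carrier A\<rbrakk> \<Longrightarrow> y \<preceq> x \<curlyvee> y"
  by (metis join_comm join_ge1)

lemma join_least:
  "\<lbrakk>x \<preceq> z; y \<preceq> z; x \<in> carrier A; y \<in> carrier A; z \<in> carrier A\<rbrakk> \<Longrightarrow> x \<curlyvee> y \<preceq> z"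
  by (metis join_assoc join_closed le_iff_join)

lemma mult_mono1:
  assumes "x \<preceq> y" "x \<in> carrier A" "y \<in> carrier A" "z \<in> carrier A"
  shows "x \<otimes> z \<preceq> y \<otimes> z"
proof -
  have "y \<preceq> z \<leadsto> (y \<otimes> z)" using assms by (simp add: residuation)
  then have "x \<preceq> z \<leadsto> (y \<otimes> z)" using assms by (meson le_trans m_closed resid_closed)
  then show ?thesis using assms by (simp add: residuation)
qed

lemma mult_mono2:
  "\<lbrakk>x \<preceq> y; x \<in> carrier A; y \<in> carrier A; z \<in> carrier A\<rbrakk> \<Longrightarrow> z \<otimes> x \<preceq> z \<otimes> y"
  by (metis m_comm mult_mono1)

lemma mult_le2: "\<lbrakk>x \<in> carrier A; y \<in> carrier A\<rbrakk> \<Longrightarrow> x \<otimes> y \<preceq> y"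
  using mult_mono1[OF one_greatest, of x y] by simp

lemma mult_le1: "\<lbrakk>x \<in> carrier A; y \<in> carrier A\<rbrakk> \<Longrightarrow> x \<otimes> y \<preceq> x"
  by (metis m_comm mult_le2)

lemma resid_mp: "\<lbrakk>x \<in> carrier A; y \<in> carrier A\<rbrakk> \<Longrightarrow> (x \<leadsto> y) \<otimes> x \<preceq> y"
  using residuation[of "x \<leadsto> y" x y] by simp

end

locale rl_with_filter = residuated_lattice +
  fixes F
  assumes filt: "rl_filter A F"
begin

lemma F_carrier: "x \<in> F \<Longrightarrow> x \<in> carrier A"
  using filt by (auto simp: rl_filter_def)

lemma F_mult: "\<lbrakk>x \<in> F; y \<in> F\<rbrakk> \<Longrightarrow> x \<otimes> y \<in> F"
  using filt by (auto simp: rl_filter_def)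

lemma F_up: "\<lbrakk>x \<in> F; x \<preceq> y; y \<in> carrier A\<rbrakk> \<Longrightarrow> y \<in> F"
  using filt by (auto simp: rl_filter_def)

lemma F_one: "\<one> \<in> F"
  using filt F_up one_greatest F_carrier by (auto simp: rl_filter_def)

definition leF :: "'a \<Rightarrow> 'a \<Rightarrow> bool"
  where "leF x y \<longleftrightarrow> (\<exists>f\<in>F. f \<otimes> x \<preceq> y)"

lemma leF_iff: "\<lbrakk>x \<in> carrier A; y \<in> carrier A\<rbrakk> \<Longrightarrow> leF x y \<longleftrightarrow> x \<leadsto> y \<in> F"
  unfolding leF_def by (meson F_carrier F_up residuation resid_closed resid_mp)

lemma le_leF: "\<lbrakk>x \<preceq> y; x \<in> carrier A\<rbrakk> \<Longrightarrow> leF x y"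
  unfolding leF_def using F_one by (metis l_one)

lemma leF_refl: "x \<in> carrier A \<Longrightarrow> leF x x"
  by (simp add: le_leF)

lemma leF_trans:
  assumes "leF x y" "leF y z" "x \<in> carrier A" "y \<in> carrier A" "z \<in> carrier A"
  shows "leF x z"
proof -
  obtain f g where fg: "f \<in> F" "f \<otimes> x \<preceq> y" "g \<in> F" "g \<otimes> y \<preceq> z"
    using assms by (auto simp: leF_def)
  have c: "f \<in> carrier A" "g \<in> carrier A" using fg F_carrier by auto
  have "(g \<otimes> f) \<otimes> x \<preceq> g \<otimes> y"
    using mult_mono2[OF fg(2), of g] c assms by (simp add: m_assoc)
  then have "(g \<otimes> f) \<otimes> x \<preceq> z" using le_trans fg(4) c assms by (meson m_closed)
  then show ?thesis unfolding leF_def using F_mult fg by blast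
qed

lemma rl_cong_iff:
  "(x, y) \<in> rl_cong A F \<longleftrightarrow> x \<in> carrier A \<and> y \<in> carrier A \<and> leF x y \<and> leF y x"
proof -
  have "(x \<leadsto> y) \<curlywedge> (y \<leadsto> x) \<in> F \<longleftrightarrow> x \<leadsto> y \<in> F \<and> y \<leadsto> x \<in> F"
    if c: "x \<in> carrier A" "y \<in> carrier A"
  proof
    assume "(x \<leadsto> y) \<curlywedge> (y \<leadsto> x) \<in> F"
    then show "x \<leadsto> y \<in> F \<and> y \<leadsto> x \<in> F"
      using F_up meet_le1 meet_le2 c by (meson resid_closed)
  next
    assume "x \<leadsto> y \<in> F \<and> y \<leadsto> x \<in> F"
    then have "(x \<leadsto> y) \<otimes> (y \<leadsto> x) \<in> F" using F_mult by blast
    then show "(x \<leadsto> y) \<curlywedge> (y \<leadsto> x) \<in> F"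
      using c by (meson F_up m_closed meet_closed meet_greatest mult_le1 mult_le2 resid_closed)
  qed
  then show ?thesis by (auto simp: rl_cong_def rl_bires_def leF_iff)
qed

lemma equiv_rl_cong: "equiv (carrier A) (rl_cong A F)"
proof (rule equivI)
  show "rl_cong A F \<subseteq> carrier A \<times> carrier A" by (auto simp: rl_cong_def)
  show "refl_on (carrier A) (rl_cong A F)"
    by (auto simp: refl_on_def rl_cong_iff leF_refl)
  show "sym (rl_cong A F)" by (auto simp: sym_def rl_cong_iff)
  show "trans (rl_cong A F)" by (auto simp: trans_def rl_cong_iff intro: leF_trans)
qed

lemma class_eq_iff:
  "\<lbrakk>x \<in> carrier A; y \<in> carrier A\<rbrakk> \<Longrightarrow>
    rl_class A F x = rl_class A F y \<longleftrightarrow> leF x y \<and> leF y x"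
  unfolding rl_class_def by (simp add: eq_equiv_class_iff[OF equiv_rl_cong] rl_cong_iff)

lemma leF_mult:
  assumes "leF x x'" "leF y y'" "x \<in> carrier A" "y \<in> carrier A" "x' \<in> carrier A" "y' \<in> carrier A"
  shows "leF (x \<otimes> y) (x' \<otimes> y')"
proof -
  obtain f g where fg: "f \<in> F" "f \<otimes> x \<preceq> x'" "g \<in> F" "g \<otimes> y \<preceq> y'"
    using assms by (auto simp: leF_def)
  have c: "f \<in> carrier A" "g \<in> carrier A" using fg F_carrier by auto
  have "(f \<otimes> x) \<otimes> (g \<otimes> y) \<preceq> x' \<otimes> (g \<otimes> y)" using mult_mono1 fg c assms by simp
  moreover have "x' \<otimes> (g \<otimes> y) \<preceq> x' \<otimes> y'" using mult_mono2 fg c assms by simp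
  ultimately have "(f \<otimes> x) \<otimes> (g \<otimes> y) \<preceq> x' \<otimes> y'"
    using le_trans c assms by (meson m_closed)
  moreover have "(f \<otimes> x) \<otimes> (g \<otimes> y) = (f \<otimes> g) \<otimes> (x \<otimes> y)"
    using c assms by (simp add: m_ac)
  ultimately show ?thesis unfolding leF_def using F_mult fg by metis
qed

lemma leF_meet_greatest:
  assumes "leF z x" "leF z y" "x \<in> carrier A" "y \<in> carrier A" "z \<in> carrier A"
  shows "leF z (x \<curlywedge> y)"
proof -
  obtain f g where fg: "f \<in> F" "f \<otimes> z \<preceq> x" "g \<in> F" "g \<otimes> z \<preceq> y"
    using assms by (auto simp: leF_def)
  have c: "f \<in> carrier A" "g \<in> carrier A" using fg F_carrier by auto
  have "(f \<otimes> g) \<otimes> z \<preceq> f \<otimes> z" "(f \<otimes> g) \<otimes> z \<preceq> g \<otimes> z"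
    using c assms by (auto intro!: mult_mono1 mult_le1 mult_le2)
  then have "(f \<otimes> g) \<otimes> z \<preceq> x \<curlywedge> y"
    using c assms fg by (meson le_trans m_closed meet_greatest)
  then show ?thesis unfolding leF_def using F_mult fg by blast
qed

lemma leF_join_least:
  assumes "leF x z" "leF y z" "x \<in> carrier A" "y \<in> carrier A" "z \<in> carrier A"
  shows "leF (x \<curlyvee> y) z"
proof -
  obtain f g where fg: "f \<in> F" "f \<otimes> x \<preceq> z" "g \<in> F" "g \<otimes> y \<preceq> z"
    using assms by (auto simp: leF_def)
  have c: "f \<in> carrier A" "g \<in> carrier A" using fg F_carrier by auto
  have *: "(f \<otimes> g) \<otimes> x \<preceq> f \<otimes> x" "(f \<otimes> g) \<otimes> y \<preceq> g \<otimes> y"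
    using c assms by (auto intro!: mult_mono1 mult_le1 mult_le2)
  have "(f \<otimes> g) \<otimes> x \<preceq> z"
    by (rule le_trans[OF *(1) fg(2)]) (use c assms in auto)
  moreover have "(f \<otimes> g) \<otimes> y \<preceq> z"
    by (rule le_trans[OF *(2) fg(4)]) (use c assms in auto)
  ultimately have "x \<preceq> (f \<otimes> g) \<leadsto> z" "y \<preceq> (f \<otimes> g) \<leadsto> z"
    using c assms by (simp_all add: residuation m_comm[of _ "f \<otimes> g"])
  then have "x \<curlyvee> y \<preceq> (f \<otimes> g) \<leadsto> z" using c assms by (simp add: join_least)
  then have "(f \<otimes> g) \<otimes> (x \<curlyvee> y) \<preceq> z"
    using c assms by (simp add: residuation m_comm[of _ "f \<otimes> g"])
  then show ?thesis unfolding leF_def using F_mult fg by blast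
qed

lemma leF_residuation:
  assumes "x \<in> carrier A" "y \<in> carrier A" "z \<in> carrier A"
  shows "leF x (y \<leadsto> z) \<longleftrightarrow> leF (x \<otimes> y) z"
proof -
  have "f \<otimes> x \<preceq> y \<leadsto> z \<longleftrightarrow> f \<otimes> (x \<otimes> y) \<preceq> z" if "f \<in> F" for f
    using F_carrier[OF that] assms by (simp add: residuation m_assoc)
  then show ?thesis unfolding leF_def by blast
qed

lemma leF_meet:
  assumes "leF x x'" "leF y y'" "x \<in> carrier A" "y \<in> carrier A" "x' \<in> carrier A" "y' \<in> carrier A"
  shows "leF (x \<curlywedge> y) (x' \<curlywedge> y')"
  using assms
  by (meson leF_meet_greatest leF_trans le_leF meet_closed meet_le1 meet_le2)

lemma leF_join:
  assumes "leF x x'" "leF y y'" "x \<in> carrier A" "y \<in> carrier A" "x' \<in> carrier A" "y' \<in> carrier A"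
  shows "leF (x \<curlyvee> y) (x' \<curlyvee> y')"
  using assms
  by (meson join_closed join_ge1 join_ge2 leF_join_least leF_trans le_leF)

lemma leF_resid:
  assumes "leF x' x" "leF y y'" "x \<in> carrier A" "y \<in> carrier A" "x' \<in> carrier A" "y' \<in> carrier A"
  shows "leF (x \<leadsto> y) (x' \<leadsto> y')"
proof -
  have "leF ((x \<leadsto> y) \<otimes> x') ((x \<leadsto> y) \<otimes> x)"
    using assms by (simp add: leF_mult leF_refl)
  moreover have "leF ((x \<leadsto> y) \<otimes> x) y"
    using assms by (simp add: le_leF resid_mp)
  ultimately have "leF ((x \<leadsto> y) \<otimes> x') y'"
    using assms by (meson leF_trans m_closed resid_closed)
  then show ?thesis using assms by (simp add: leF_residuation)
qed

lemma lift_op_class: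
  assumes x: "x \<in> carrier A" and y: "y \<in> carrier A"
    and closed: "\<And>x y. \<lbrakk>x \<in> carrier A; y \<in> carrier A\<rbrakk> \<Longrightarrow> f x y \<in> carrier A"
    and mono: "\<And>x y x' y'. \<lbrakk>(x, x') \<in> rl_cong A F; (y, y') \<in> rl_cong A F\<rbrakk>
      \<Longrightarrow> leF (f x y) (f x' y')"
  shows "lift_op A F f (rl_class A F x) (rl_class A F y) = rl_class A F (f x y)"
proof -
  have s: "(b, a) \<in> rl_cong A F" if "(a, b) \<in> rl_cong A F" for a b
    using that by (simp add: rl_cong_iff)
  have "congruent2 (rl_cong A F) (rl_cong A F) (\<lambda>x y. rl_class A F (f x y))"
  proof (rule congruent2I')
    fix y1 z1 y2 z2
    assume r: "(y1, z1) \<in> rl_cong A F" "(y2, z2) \<in> rl_cong A F"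
    then have "f y1 y2 \<in> carrier A" "f z1 z2 \<in> carrier A"
      using closed by (auto simp: rl_cong_iff)
    then show "rl_class A F (f y1 y2) = rl_class A F (f z1 z2)"
      using r s mono by (simp add: class_eq_iff)
  qed
  then show ?thesis
    unfolding lift_op_def rl_class_def[of A F x] rl_class_def[of A F y]
    by (rule UN_equiv_class2[OF equiv_rl_cong equiv_rl_cong _ x y])
qed

lemma carrier_quot: "carrier (rl_quot A F) = rl_class A F ` carrier A"
  by (auto simp: rl_quot_def rl_class_def quotient_def)

lemma quot_class_simps:
  assumes "x \<in> carrier A" "y \<in> carrier A"
  shows "rl_class A F x \<otimes>\<^bsub>rl_quot A F\<^esub> rl_class A F y = rl_class A F (x \<otimes> y)"
    and "rl_class A F x \<curlyvee>\<^bsub>rl_quot A F\<^esub> rl_class A F y = rl_class A F (x \<curlyvee> y)"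
    and "rl_class A F x \<curlywedge>\<^bsub>rl_quot A F\<^esub> rl_class A F y = rl_class A F (x \<curlywedge> y)"
    and "rl_class A F x \<leadsto>\<^bsub>rl_quot A F\<^esub> rl_class A F y = rl_class A F (x \<leadsto> y)"
  using assms unfolding rl_quot_def
  by (simp_all, (rule lift_op_class; auto simp: rl_cong_iff leF_mult leF_join leF_meet leF_resid)+)

lemma quot_consts:
  "\<one>\<^bsub>rl_quot A F\<^esub> = rl_class A F \<one>" "\<zero>\<^bsub>rl_quot A F\<^esub> = rl_class A F \<zero>"
  by (simp_all add: rl_quot_def)

lemma quot_le_iff:
  assumes "x \<in> carrier A" "y \<in> carrier A"
  shows "rl_class A F x \<preceq>\<^bsub>rl_quot A F\<^esub> rl_class A F y \<longleftrightarrow> leF x y"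
proof -
  have "leF (x \<curlywedge> y) x" "leF (x \<curlywedge> y) y" using assms by (simp_all add: le_leF meet_le1 meet_le2)
  then have "leF (x \<curlywedge> y) x \<and> leF x (x \<curlywedge> y) \<longleftrightarrow> leF x y"
    using assms by (meson leF_meet_greatest leF_refl leF_trans meet_closed)
  then show ?thesis
    using assms by (simp add: rl_le_def[of "rl_quot A F"] quot_class_simps class_eq_iff)
qed

lemma residuated_lattice_quot: "residuated_lattice (rl_quot A F)"
  by unfold_locales
    (clarsimp simp: carrier_quot quot_class_simps quot_consts quot_le_iff m_assoc join_assoc
      meet_assoc join_absorb meet_absorb le_leF zero_least one_greatest leF_residuation;
      simp add: m_comm join_comm meet_comm)+

end

end

theory Submission
  imports Defs
begin

text \<open>
  Two elements with join \<open>\<one>\<close> have meet equal to their product, because \<open>\<otimes>\<close> distributes over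
  joins. Hence, when \<open>x \<otimes> y = \<zero>\<close>, the classes of \<open>x\<close> and \<open>y\<close> are complements of each other modulo
  the filter \<open>[x \<curlyvee> y)\<close>, and this is the smallest filter for which they are. Lifting the class of \<open>x\<close>
  along this filter to a Boolean \<open>e\<close> gives exactly \<open>e \<in> [x)\<close> and \<open>\<not>e \<in> [y)\<close>. This is how BLP yields
  the binary condition (\<open>BLP_imp_splitting\<close>), of which the unary one is the case \<open>y = \<not>x\<close>.

  Conversely, let \<open>x\<close> and \<open>y\<close> be complements modulo an arbitrary filter \<open>F\<close>, and let \<open>e\<close> be a Boolean
  element with \<open>e \<in> [x)\<close> and \<open>\<not>e \<in> [\<not>x)\<close>. Modulo \<open>F\<close> both \<open>x\<close> and \<open>y\<close> are idempotent, so each lies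
  below every element of the principal filter of anything above it; thus \<open>x\<close> lies below \<open>e\<close>, and
  \<open>y\<close>, being below \<open>\<not>x\<close>, lies below \<open>\<not>e\<close>. Since \<open>x \<curlyvee> y\<close> is \<open>\<one>\<close> modulo \<open>F\<close>, the second fact puts
  \<open>e\<close> below \<open>x\<close>, and so \<open>e\<close> lifts the class of \<open>x\<close> (\<open>unary_splitting_imp_BLP\<close>).

  The \<open>n\<close>-ary condition is obtained from the binary one by splitting off one factor at a time.
  After the first step the product of the remaining factors need not be \<open>\<zero>\<close>; it is only known that
  a power of it lies below some Boolean element. Therefore the induction is carried out for the
  statement relativised to an arbitrary Boolean element in place of \<open>\<zero>\<close> (\<open>splitting_relative\<close>,
  \<open>splitting_finite\<close>). Conversely, the case \<open>n = 2\<close> is the binary condition, because an element has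
  at most one complement and \<open>e\<^sub>2\<close> must thus be \<open>\<not>e\<^sub>1\<close> (\<open>complement_eq_neg\<close>).
\<close>

section \<open>Coprime elements and the Boolean center\<close>

context residuated_lattice
begin

lemma neg_closed [intro, simp]: "x \<in> carrier A \<Longrightarrow> rl_neg A x \<in> carrier A"
  by (simp add: rl_neg_def)

lemma le_zero_iff: "x \<in> carrier A \<Longrightarrow> x \<preceq> \<zero> \<longleftrightarrow> x = \<zero>"
  by (metis le_antisym le_refl zero_closed zero_least)

lemma one_le_iff: "x \<in> carrier A \<Longrightarrow> \<one> \<preceq> x \<longleftrightarrow> x = \<one>"
  by (metis le_antisym le_refl one_closed one_greatest)

lemma le_neg_iff:
  "\<lbrakk>x \<in> carrier A; y \<in> carrier A\<rbrakk> \<Longrightarrow> x \<preceq> rl_neg A y \<longleftrightarrow> x \<otimes> y = \<zero>"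
  by (simp add: rl_neg_def residuation le_zero_iff)

lemma mult_neg: "x \<in> carrier A \<Longrightarrow> x \<otimes> rl_neg A x = \<zero>"
  by (metis le_neg_iff le_refl m_comm neg_closed)

lemma mult_mono:
  assumes "x \<preceq> x'" "y \<preceq> y'"
    and "x \<in> carrier A" "x' \<in> carrier A" "y \<in> carrier A" "y' \<in> carrier A"
  shows "x \<otimes> y \<preceq> x' \<otimes> y'"
  using assms by (meson le_trans m_closed mult_mono1 mult_mono2)

text \<open>As \<open>z \<otimes> _\<close> is a left adjoint, an upper bound of \<open>z \<otimes> x\<close> and \<open>z \<otimes> y\<close> bounds
  \<open>z \<otimes> (x \<curlyvee> y)\<close>; this form of distributivity is the one used below.\<close>

lemma mult_join_least:
  assumes "z \<otimes> x \<preceq> w" "z \<otimes> y \<preceq> w"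
    and "x \<in> carrier A" "y \<in> carrier A" "z \<in> carrier A" "w \<in> carrier A"
  shows "z \<otimes> (x \<curlyvee> y) \<preceq> w"
proof -
  have "x \<preceq> z \<leadsto> w" "y \<preceq> z \<leadsto> w" using assms by (simp_all add: residuation m_comm)
  then have "x \<curlyvee> y \<preceq> z \<leadsto> w" using assms by (simp add: join_least)
  then show ?thesis using assms by (simp add: residuation m_comm)
qed

lemma coprime_meet:
  assumes "a \<curlyvee> b = \<one>" "a \<in> carrier A" "b \<in> carrier A"
  shows "a \<curlywedge> b = a \<otimes> b"
proof (rule le_antisym)
  have "(a \<curlywedge> b) \<otimes> a \<preceq> b \<otimes> a" "(a \<curlywedge> b) \<otimes> b \<preceq> a \<otimes> b"
    using assms by (auto intro!: mult_mono1 meet_le1 meet_le2)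
  then have "(a \<curlywedge> b) \<otimes> (a \<curlyvee> b) \<preceq> a \<otimes> b"
    using assms by (intro mult_join_least) (simp_all add: m_comm)
  then show "a \<curlywedge> b \<preceq> a \<otimes> b" using assms by simp
  show "a \<otimes> b \<preceq> a \<curlywedge> b" using assms by (simp add: meet_greatest mult_le1 mult_le2)
qed (use assms in auto)

lemma coprime_mult:
  assumes "a \<curlyvee> b = \<one>" "a \<curlyvee> c = \<one>" "a \<in> carrier A" "b \<in> carrier A" "c \<in> carrier A"
  shows "a \<curlyvee> (b \<otimes> c) = \<one>"
proof -
  have "b \<otimes> a \<preceq> a \<curlyvee> (b \<otimes> c)"
    using assms by (meson join_closed join_ge1 le_trans m_closed mult_le2)
  then have "b \<otimes> (a \<curlyvee> c) \<preceq> a \<curlyvee> (b \<otimes> c)"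
    using assms by (intro mult_join_least) (auto simp: join_ge2)
  then have "a \<curlyvee> b \<preceq> a \<curlyvee> (b \<otimes> c)"
    using assms by (intro join_least) (simp_all add: join_ge1)
  then show ?thesis using assms by (simp add: one_le_iff)
qed

lemma coprime_pow:
  assumes "a \<curlyvee> b = \<one>" "a \<in> carrier A" "b \<in> carrier A"
  shows "a \<curlyvee> b [^] (n::nat) = \<one>"
proof (induction n)
  case 0
  then show ?case using assms by (metis le_iff_join nat_pow_0 one_closed one_greatest)
next
  case (Suc n)
  then show ?case using assms by (simp add: coprime_mult)
qed

lemma coprime_mono:
  assumes "a \<curlyvee> b = \<one>" "a \<preceq> a'" "b \<preceq> b'"
    and "a \<in> carrier A" "b \<in> carrier A" "a' \<in> carrier A" "b' \<in> carrier A"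
  shows "a' \<curlyvee> b' = \<one>"
proof -
  have "a \<curlyvee> b \<preceq> a' \<curlyvee> b'"
    using assms by (meson join_closed join_ge1 join_ge2 join_least le_trans)
  then show ?thesis using assms by (simp add: one_le_iff)
qed

text \<open>If \<open>e \<curlyvee> f = \<one>\<close> and \<open>e \<otimes> f = \<zero>\<close>, then \<open>f\<close> is the largest element that \<open>e\<close> annihilates: any
  such \<open>z\<close> equals \<open>z \<otimes> (e \<curlyvee> f)\<close>, hence lies below \<open>f\<close>.\<close>

lemma complement_eq_neg:
  assumes "e \<curlyvee> f = \<one>" "e \<otimes> f = \<zero>" "e \<in> carrier A" "f \<in> carrier A"
  shows "f = rl_neg A e"
proof (rule le_antisym)
  show "f \<preceq> rl_neg A e" using assms by (simp add: le_neg_iff m_comm)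
  have "rl_neg A e \<otimes> (e \<curlyvee> f) \<preceq> f"
    using assms
    by (intro mult_join_least mult_le2) (auto simp: m_comm[of "rl_neg A e"] mult_neg zero_least)
  then show "rl_neg A e \<preceq> f" using assms by simp
qed (use assms in auto)

text \<open>By coprimality the meet condition in the definition of a complement is automatic for \<open>\<not>e\<close>,
  so being Boolean amounts to excluded middle.\<close>

lemma boolean_center_iff:
  "e \<in> boolean_center A \<longleftrightarrow> e \<in> carrier A \<and> e \<curlyvee> rl_neg A e = \<one>"
proof
  assume "e \<in> boolean_center A"
  then obtain f where "e \<in> carrier A" "f \<in> carrier A" "e \<curlyvee> f = \<one>" "e \<curlywedge> f = \<zero>"
    by (auto simp: boolean_center_def)
  then show "e \<in> carrier A \<and> e \<curlyvee> rl_neg A e = \<one>"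
    by (metis coprime_meet complement_eq_neg)
next
  assume "e \<in> carrier A \<and> e \<curlyvee> rl_neg A e = \<one>"
  then show "e \<in> boolean_center A"
    unfolding boolean_center_def using coprime_meet mult_neg neg_closed by fastforce
qed

lemma boolean_neg:
  assumes "e \<in> boolean_center A"
  shows "rl_neg A e \<in> boolean_center A"
proof -
  have e: "e \<in> carrier A" "e \<curlyvee> rl_neg A e = \<one>" using assms by (simp_all add: boolean_center_iff)
  then have "e \<curlywedge> rl_neg A e = \<zero>" by (simp add: coprime_meet mult_neg)
  then show ?thesis
    unfolding boolean_center_def using e by (auto simp: join_comm meet_comm)
qed

lemma boolean_join:
  assumes "e \<in> boolean_center A" "g \<in> boolean_center A"
  shows "e \<curlyvee> g \<in> boolean_center A"
proof -
  have c: "e \<in> carrier A" "g \<in> carrier A"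
    and em: "e \<curlyvee> rl_neg A e = \<one>" "g \<curlyvee> rl_neg A g = \<one>"
    using assms by (simp_all add: boolean_center_iff)
  let ?u = "rl_neg A e \<otimes> rl_neg A g"
  have "(e \<curlyvee> g) \<curlyvee> rl_neg A e = \<one>"
    by (rule coprime_mono[OF em(1)]) (use c in \<open>auto simp: join_ge1\<close>)
  moreover have "(e \<curlyvee> g) \<curlyvee> rl_neg A g = \<one>"
    by (rule coprime_mono[OF em(2)]) (use c in \<open>auto simp: join_ge2\<close>)
  ultimately have cop: "(e \<curlyvee> g) \<curlyvee> ?u = \<one>" using c by (simp add: coprime_mult)
  have "?u \<otimes> e \<preceq> \<zero>"
    using c by (metis m_assoc m_comm m_closed mult_neg mult_le1 neg_closed zero_closed)
  moreover have "?u \<otimes> g \<preceq> \<zero>"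
    using c by (metis m_assoc m_comm m_closed mult_neg mult_le2 neg_closed zero_closed)
  ultimately have "?u \<otimes> (e \<curlyvee> g) \<preceq> \<zero>" using c by (simp add: mult_join_least)
  then have "?u \<preceq> rl_neg A (e \<curlyvee> g)" using c by (simp add: le_neg_iff le_zero_iff)
  then have "(e \<curlyvee> g) \<curlyvee> rl_neg A (e \<curlyvee> g) = \<one>"
    using c by (intro coprime_mono[OF cop]) auto
  then show ?thesis using c by (simp add: boolean_center_iff)
qed

end

section \<open>Principal filters\<close>

lemma (in rl_with_filter) F_pow: "x \<in> F \<Longrightarrow> x [^] (n::nat) \<in> F"
  by (induction n) (simp_all add: F_one F_mult)

context residuated_lattice
begin

lemma principal_filter_is_filter:
  assumes "x \<in> carrier A"
  shows "rl_filter A (principal_filter A x)"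
  unfolding rl_filter_def
proof (intro conjI ballI impI)
  show "principal_filter A x \<subseteq> carrier A" by (auto simp: principal_filter_def)
  have "\<one> \<in> principal_filter A x"
    unfolding principal_filter_def using assms one_greatest by auto
  then show "principal_filter A x \<noteq> {}" by blast
next
  fix a b assume "a \<in> principal_filter A x" "b \<in> principal_filter A x"
  then obtain m n :: nat where mn: "m \<ge> 1" "x [^] m \<preceq> a" "n \<ge> 1" "x [^] n \<preceq> b"
    and c: "a \<in> carrier A" "b \<in> carrier A"
    by (auto simp: principal_filter_def)
  have "x [^] (m + n) \<preceq> a \<otimes> b"
    using mn c assms by (simp add: mult_mono flip: nat_pow_mult)
  then show "a \<otimes> b \<in> principal_filter A x"
    unfolding principal_filter_def using mn c by (auto intro!: exI[of _ "m + n"])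
next
  fix a b assume "a \<in> principal_filter A x" "b \<in> carrier A" "a \<preceq> b"
  then show "b \<in> principal_filter A x"
    unfolding principal_filter_def using assms by (blast intro: le_trans nat_pow_closed)
qed

lemma principal_filter_rl_with_filter:
  "x \<in> carrier A \<Longrightarrow> rl_with_filter A (principal_filter A x)"
  by (simp add: rl_with_filter_def rl_with_filter_axioms_def principal_filter_is_filter
      residuated_lattice_axioms)

lemma principal_filter_self: "x \<in> carrier A \<Longrightarrow> x \<in> principal_filter A x"
  unfolding principal_filter_def by (auto intro!: exI[of _ "1::nat"])

lemma principal_filter_least:
  assumes "rl_filter A F" "x \<in> F"
  shows "principal_filter A x \<subseteq> F"
proof -
  interpret rl_with_filter A F by unfold_locales (rule assms)
  show ?thesis
    unfolding principal_filter_def using F_pow[OF assms(2)] F_up by blast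
qed

lemma principal_filter_up:
  "\<lbrakk>a \<in> principal_filter A x; a \<preceq> b; x \<in> carrier A; b \<in> carrier A\<rbrakk> \<Longrightarrow> b \<in> principal_filter A x"
  using rl_with_filter.F_up[OF principal_filter_rl_with_filter] by blast

lemma principal_filter_mult:
  "\<lbrakk>a \<in> principal_filter A x; b \<in> principal_filter A x; x \<in> carrier A\<rbrakk>
    \<Longrightarrow> a \<otimes> b \<in> principal_filter A x"
  using rl_with_filter.F_mult[OF principal_filter_rl_with_filter] by blast

lemma principal_filter_trans:
  "\<lbrakk>a \<in> principal_filter A y; y \<in> principal_filter A x; x \<in> carrier A\<rbrakk>
    \<Longrightarrow> a \<in> principal_filter A x"
  using principal_filter_least[OF principal_filter_is_filter] by blast

lemma principal_filter_antimono:
  "\<lbrakk>a \<in> principal_filter A y; x \<preceq> y; x \<in> carrier A; y \<in> carrier A\<rbrakk>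
    \<Longrightarrow> a \<in> principal_filter A x"
  using principal_filter_trans principal_filter_up principal_filter_self by blast

lemma principal_filter_pow:
  "\<lbrakk>a \<in> principal_filter A (x [^] (n::nat)); x \<in> carrier A\<rbrakk> \<Longrightarrow> a \<in> principal_filter A x"
  using principal_filter_trans principal_filter_self
    rl_with_filter.F_pow[OF principal_filter_rl_with_filter] by blast

end

section \<open>Complements modulo a filter\<close>

context rl_with_filter
begin

lemma boolean_center_quot_iff:
  assumes "x \<in> carrier A"
  shows "rl_class A F x \<in> boolean_center (rl_quot A F) \<longleftrightarrow>
    (\<exists>y \<in> carrier A. leF \<one> (x \<curlyvee> y) \<and> leF (x \<curlywedge> y) \<zero>)"
proof -
  have "leF z \<one>" "leF \<zero> z" if "z \<in> carrier A" for z
    using that by (simp_all add: le_leF one_greatest zero_least)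
  then show ?thesis
    using assms by (auto simp: boolean_center_def carrier_quot quot_class_simps quot_consts
        class_eq_iff)
qed

lemma class_boolean:
  assumes "e \<in> boolean_center A"
  shows "rl_class A F e \<in> boolean_center (rl_quot A F)"
proof -
  obtain f where f: "e \<in> carrier A" "f \<in> carrier A" "e \<curlyvee> f = \<one>" "e \<curlywedge> f = \<zero>"
    using assms by (auto simp: boolean_center_def)
  then show ?thesis
    using leF_refl[of \<one>] leF_refl[of \<zero>] by (auto simp: boolean_center_quot_iff intro!: bexI[of _ f])
qed

text \<open>An element \<open>x\<close> with a complement modulo \<open>F\<close> is idempotent modulo \<open>F\<close>, since
  \<open>x \<otimes> (x \<curlyvee> y)\<close> is below \<open>x \<otimes> x\<close> there. Therefore the elements above \<open>x\<close> modulo \<open>F\<close> form a filter,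
  and this filter contains \<open>[u)\<close> as soon as it contains \<open>u\<close>.\<close>

lemma complemented_le_principal_filter:
  assumes one: "leF \<one> (x \<curlyvee> y)" and zero: "leF (x \<otimes> y) \<zero>"
    and xu: "leF x u" and a: "a \<in> principal_filter A u"
    and c: "x \<in> carrier A" "y \<in> carrier A" "u \<in> carrier A"
  shows "leF x a"
proof -
  have "leF (x \<otimes> \<one>) (x \<otimes> (x \<curlyvee> y))" using one c by (simp add: leF_mult leF_refl del: r_one)
  moreover have "leF (x \<otimes> (x \<curlyvee> y)) ((x \<otimes> x) \<curlyvee> (x \<otimes> y))"
    using c by (intro le_leF mult_join_least) (auto simp: join_ge1 join_ge2)
  moreover have "leF ((x \<otimes> x) \<curlyvee> (x \<otimes> y)) (x \<otimes> x)"
  proof (rule leF_join_least)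
    have "leF \<zero> (x \<otimes> x)" using c by (simp add: le_leF zero_least)
    then show "leF (x \<otimes> y) (x \<otimes> x)" using zero c by (meson leF_trans m_closed zero_closed)
  qed (use c in \<open>auto simp: leF_refl\<close>)
  ultimately have idem: "leF x (x \<otimes> x)"
    using c by (metis leF_trans r_one m_closed join_closed)
  let ?G = "{z \<in> carrier A. leF x z}"
  have "rl_filter A ?G"
    unfolding rl_filter_def
  proof (intro conjI ballI impI)
    show "?G \<noteq> {}" using xu c by blast
    fix v w assume vw: "v \<in> ?G"
    {
      assume "w \<in> ?G"
      then have "leF (x \<otimes> x) (v \<otimes> w)" using vw c by (simp add: leF_mult)
      then have "leF x (v \<otimes> w)" using idem \<open>w \<in> ?G\<close> vw c leF_trans[of x "x \<otimes> x"] by simp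
      then show "v \<otimes> w \<in> ?G" using \<open>w \<in> ?G\<close> vw by simp
    }
    {
      assume "w \<in> carrier A" "v \<preceq> w"
      then show "w \<in> ?G" using vw c leF_trans[of x v w] le_leF[of v w] by simp
    }
  qed auto
  then have "principal_filter A u \<subseteq> ?G" using xu c by (simp add: principal_filter_least)
  then show ?thesis using a by blast
qed

end

section \<open>Boolean lifting as splitting of zero products\<close>

context residuated_lattice
begin

lemma BLP_imp_splitting:
  assumes blp: "BLP A" and c: "x \<in> carrier A" "y \<in> carrier A" and xy: "x \<otimes> y = \<zero>"
  shows "\<exists>e \<in> boolean_center A. e \<in> principal_filter A x \<and> rl_neg A e \<in> principal_filter A y"
proof -
  let ?F = "principal_filter A (x \<curlyvee> y)"
  interpret rl_with_filter A ?F using c by (simp add: principal_filter_rl_with_filter)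
  have F_x: "f \<in> principal_filter A x" and F_y: "f \<in> principal_filter A y" if "f \<in> ?F" for f
    using principal_filter_antimono[OF that] c by (auto simp: join_ge1 join_ge2)
  have F: "x \<curlyvee> y \<in> ?F" using c by (simp add: principal_filter_self)
  \<comment> \<open>Modulo \<open>?F\<close> the join of \<open>x\<close> and \<open>y\<close> is \<open>\<one>\<close>, so their meet is their product.\<close>
  have one: "leF \<one> (x \<curlyvee> y)"
    unfolding leF_def using F c by (intro bexI[of _ "x \<curlyvee> y"]) simp_all
  have "(x \<curlyvee> y) \<otimes> (x \<curlywedge> y) \<preceq> \<zero>"
  proof -
    have "(x \<curlywedge> y) \<otimes> x \<preceq> y \<otimes> x" "(x \<curlywedge> y) \<otimes> y \<preceq> x \<otimes> y"
      using c by (auto intro!: mult_mono1 meet_le1 meet_le2)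
    then have "(x \<curlywedge> y) \<otimes> (x \<curlyvee> y) \<preceq> \<zero>"
      using c xy by (intro mult_join_least) (simp_all add: m_comm)
    then show ?thesis using c by (simp add: m_comm)
  qed
  then have "leF (x \<curlywedge> y) \<zero>" unfolding leF_def using F by blast
  then have "rl_class A ?F x \<in> boolean_center (rl_quot A ?F)"
    using one c by (auto simp: boolean_center_quot_iff)
  then obtain e where e: "e \<in> boolean_center A" "rl_class A ?F x = rl_class A ?F e"
    using blp filt by (auto simp: BLP_def filter_BLP_def)
  have ec: "e \<in> carrier A" using e by (simp add: boolean_center_iff)
  obtain f g where fg: "f \<in> ?F" "f \<otimes> x \<preceq> e" "g \<in> ?F" "g \<otimes> e \<preceq> x"
    using e ec c by (auto simp: class_eq_iff leF_def)
  have gc: "g \<in> carrier A" using fg F_carrier by auto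
  have "f \<otimes> x \<in> principal_filter A x"
    using F_x[OF fg(1)] c by (simp add: principal_filter_mult principal_filter_self)
  then have ex: "e \<in> principal_filter A x"
    using fg(2) c ec by (blast intro: principal_filter_up)
  have "(g \<otimes> e) \<otimes> y \<preceq> x \<otimes> y" using fg(4) gc ec c by (simp add: mult_mono1)
  then have "(g \<otimes> y) \<otimes> e \<preceq> \<zero>" using gc ec c xy by (simp add: m_ac)
  then have "g \<otimes> y \<preceq> rl_neg A e" using gc ec c by (simp add: le_neg_iff le_zero_iff)
  moreover have "g \<otimes> y \<in> principal_filter A y"
    using F_y[OF fg(3)] c by (simp add: principal_filter_mult principal_filter_self)
  ultimately have "rl_neg A e \<in> principal_filter A y"
    using c ec by (blast intro: principal_filter_up)
  then show ?thesis using e(1) ex by blast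
qed

lemma unary_splitting_imp_BLP:
  assumes split: "\<And>x. x \<in> carrier A \<Longrightarrow> \<exists>e \<in> boolean_center A.
    e \<in> principal_filter A x \<and> rl_neg A e \<in> principal_filter A (rl_neg A x)"
  shows "BLP A"
  unfolding BLP_def filter_BLP_def
proof (intro allI impI)
  fix F assume "rl_filter A F"
  then interpret rl_with_filter A F by unfold_locales
  show "boolean_center (rl_quot A F) = rl_class A F ` boolean_center A"
  proof
    show "rl_class A F ` boolean_center A \<subseteq> boolean_center (rl_quot A F)"
      using class_boolean by blast
    show "boolean_center (rl_quot A F) \<subseteq> rl_class A F ` boolean_center A"
    proof
      fix X assume X: "X \<in> boolean_center (rl_quot A F)"
      then obtain x where x: "x \<in> carrier A" "X = rl_class A F x"
        by (auto simp: boolean_center_def carrier_quot)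
      obtain y where y: "y \<in> carrier A" "leF \<one> (x \<curlyvee> y)" "leF (x \<curlywedge> y) \<zero>"
        using X x by (auto simp: boolean_center_quot_iff)
      obtain e where e: "e \<in> boolean_center A" "e \<in> principal_filter A x"
        "rl_neg A e \<in> principal_filter A (rl_neg A x)"
        using split x by blast
      have ec: "e \<in> carrier A" using e by (simp add: boolean_center_iff)
      have "leF (x \<otimes> y) (x \<curlywedge> y)"
        using x y by (simp add: le_leF meet_greatest mult_le1 mult_le2)
      then have xy: "leF (x \<otimes> y) \<zero>"
        using x y leF_trans[of "x \<otimes> y" "x \<curlywedge> y" \<zero>] by simp
      have xe: "leF x e"
        using complemented_le_principal_filter[OF y(2) xy leF_refl e(2)] x y by simp
      have "leF y (rl_neg A x)"
        using x y xy by (simp add: rl_neg_def leF_residuation m_comm)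
      then have "leF y (rl_neg A e)"
        using complemented_le_principal_filter[of y x "rl_neg A x"] x y xy e(3)
        by (simp add: m_comm join_comm)
      then have "leF (e \<otimes> y) \<zero>"
        using ec y by (simp add: rl_neg_def leF_residuation m_comm)
      then have ey: "leF (e \<otimes> y) x"
        using ec x y leF_trans[of "e \<otimes> y" \<zero> x] by (simp add: le_leF zero_least)
      \<comment> \<open>Modulo \<open>F\<close>, \<open>e\<close> equals \<open>e \<otimes> (x \<curlyvee> y)\<close>, and both summands are below \<open>x\<close>.\<close>
      have "leF (e \<otimes> \<one>) (e \<otimes> (x \<curlyvee> y))"
        using y x ec by (simp add: leF_mult leF_refl del: r_one)
      moreover have "leF (e \<otimes> (x \<curlyvee> y)) ((e \<otimes> x) \<curlyvee> (e \<otimes> y))"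
        using x y ec by (intro le_leF mult_join_least) (auto simp: join_ge1 join_ge2)
      moreover have "leF ((e \<otimes> x) \<curlyvee> (e \<otimes> y)) x"
        using ey x y ec by (intro leF_join_least) (auto intro: le_leF mult_le2)
      ultimately have "leF e x"
        using x y ec by (metis leF_trans r_one m_closed join_closed)
      then have "X = rl_class A F e" using x xe ec by (simp add: class_eq_iff)
      then show "X \<in> rl_class A F ` boolean_center A" using e(1) by blast
    qed
  qed
qed

end

section \<open>Splitting products of several factors\<close>

context residuated_lattice
begin

text \<open>The binary condition implies its version with any Boolean \<open>e\<close> in place of \<open>\<zero>\<close>: one splits
  \<open>x \<otimes> (y \<otimes> \<not>e) = \<zero>\<close> and joins the two resulting complements with \<open>e\<close>.\<close>

lemma splitting_relative:
  assumes split: "\<forall>x \<in> carrier A. \<forall>y \<in> carrier A. x \<otimes> y = \<zero> \<longrightarrow>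
      (\<exists>e \<in> boolean_center A. e \<in> principal_filter A x \<and> rl_neg A e \<in> principal_filter A y)"
    and e: "e \<in> boolean_center A" and xy: "x \<otimes> y \<preceq> e"
    and c: "x \<in> carrier A" "y \<in> carrier A"
  obtains g h where "g \<in> boolean_center A" "h \<in> boolean_center A"
    "g \<in> principal_filter A x" "h \<in> principal_filter A y" "g \<curlywedge> h = e" "g \<curlyvee> h = \<one>"
proof -
  have ec: "e \<in> carrier A" "e \<curlyvee> rl_neg A e = \<one>" using e by (simp_all add: boolean_center_iff)
  let ?ne = "rl_neg A e"
  have "(x \<otimes> y) \<otimes> ?ne \<preceq> e \<otimes> ?ne" using xy c ec by (simp add: mult_mono1)
  then have "x \<otimes> (y \<otimes> ?ne) = \<zero>" using c ec by (simp add: mult_neg le_zero_iff m_assoc)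
  then obtain d where d: "d \<in> boolean_center A" "d \<in> principal_filter A x"
    "rl_neg A d \<in> principal_filter A (y \<otimes> ?ne)"
    using split c ec by (meson m_closed neg_closed)
  let ?nd = "rl_neg A d" and ?g = "d \<curlyvee> e" and ?h = "rl_neg A d \<curlyvee> e"
  have dc: "d \<in> carrier A" "d \<curlyvee> ?nd = \<one>" using d by (simp_all add: boolean_center_iff)
  have B: "?g \<in> boolean_center A" "?h \<in> boolean_center A"
    using d e by (simp_all add: boolean_join boolean_neg)
  have gx: "?g \<in> principal_filter A x"
    using principal_filter_up[OF d(2) join_ge1] dc ec c by simp
  obtain k :: nat where k: "k \<ge> 1" "(y \<otimes> ?ne) [^] k \<preceq> ?nd"
    using d(3) by (auto simp: principal_filter_def)
  have "y [^] k \<otimes> ?ne [^] k \<preceq> ?nd" using k c ec by (simp add: nat_pow_distrib)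
  then have "y [^] k \<otimes> ?ne [^] k \<preceq> ?h"
    using c ec dc le_trans[OF _ join_ge1] by simp
  moreover have "y [^] k \<otimes> e \<preceq> ?h"
    using c ec dc le_trans[OF mult_le2 join_ge2] by simp
  ultimately have "y [^] k \<otimes> (e \<curlyvee> ?ne [^] k) \<preceq> ?h"
    using c ec dc by (intro mult_join_least) auto
  \<comment> \<open>No power of \<open>\<not>e\<close> loses its coprimality with \<open>e\<close>.\<close>
  then have "y [^] k \<preceq> ?h" using coprime_pow[OF ec(2)] c ec by simp
  then have hy: "?h \<in> principal_filter A y"
    unfolding principal_filter_def using k c ec dc by auto
  have gh: "?g \<curlyvee> ?h = \<one>"
    by (rule coprime_mono[OF dc(2)]) (use dc ec in \<open>auto simp: join_ge1\<close>)
  have "?nd \<otimes> ?g \<preceq> e"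
    using dc ec
    by (intro mult_join_least mult_le2) (auto simp: m_comm[of "rl_neg A d" d] mult_neg zero_least)
  then have "?g \<otimes> ?h \<preceq> e"
    using dc ec by (intro mult_join_least mult_le2) (auto simp: m_comm[of "d \<curlyvee> e"])
  then have "?g \<curlywedge> ?h \<preceq> e" using gh dc ec by (simp add: coprime_meet)
  moreover have "e \<preceq> ?g \<curlywedge> ?h" using dc ec by (simp add: meet_greatest join_ge2)
  ultimately have "?g \<curlywedge> ?h = e" using dc ec by (simp add: le_antisym)
  then show thesis using that B gx hy gh by blast
qed

lemma meet_comm_monoid: "comm_monoid \<lparr>carrier = carrier A, mult = lmeet A, one = \<one>\<rparr>"
  by (rule comm_monoidI)
    (use one_greatest in \<open>auto simp: meet_assoc rl_le_def meet_comm[of \<one>] intro: meet_comm\<close>)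

lemma finmeet_empty [simp]: "finmeet A e {} = \<one>"
  unfolding finmeet_def using comm_monoid.finprod_empty[OF meet_comm_monoid] by simp

lemma finmeet_insert:
  "\<lbrakk>finite I; a \<notin> I; e a \<in> carrier A; \<And>i. i \<in> I \<Longrightarrow> e i \<in> carrier A\<rbrakk>
    \<Longrightarrow> finmeet A e (insert a I) = e a \<curlywedge> finmeet A e I"
  unfolding finmeet_def
  by (subst comm_monoid.finprod_insert[OF meet_comm_monoid]) (auto simp: Pi_def)

lemma finmeet_closed:
  "(\<And>i. i \<in> I \<Longrightarrow> e i \<in> carrier A) \<Longrightarrow> finmeet A e I \<in> carrier A"
  unfolding finmeet_def
  using comm_monoid.finprod_closed[OF meet_comm_monoid, of e I] by (auto simp: Pi_def)

lemma finmeet_cong: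
  "\<lbrakk>\<And>i. i \<in> I \<Longrightarrow> e i = e' i; \<And>i. i \<in> I \<Longrightarrow> e' i \<in> carrier A\<rbrakk>
    \<Longrightarrow> finmeet A e I = finmeet A e' I"
  unfolding finmeet_def
  by (rule comm_monoid.finprod_cong'[OF meet_comm_monoid]) (auto simp: Pi_def)

lemma finmeet_le:
  assumes "finite I" "i \<in> I" "\<And>i. i \<in> I \<Longrightarrow> e i \<in> carrier A"
  shows "finmeet A e I \<preceq> e i"
proof -
  have "finmeet A e I = e i \<curlywedge> finmeet A e (I - {i})"
    using finmeet_insert[of "I - {i}" i e] assms by (simp add: insert_absorb)
  moreover have "finmeet A e (I - {i}) \<in> carrier A" using assms by (intro finmeet_closed) auto
  ultimately show ?thesis using assms(2,3) by (metis meet_le1)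
qed

text \<open>A factor is split off with \<open>splitting_relative\<close>; the induction hypothesis for the remaining
  factors is then applied to the Boolean element \<open>h\<close> left over for their product. Each member of the
  family so obtained is above \<open>h\<close>, hence coprime to the member split off.\<close>

lemma splitting_finite:
  assumes split: "\<forall>x \<in> carrier A. \<forall>y \<in> carrier A. x \<otimes> y = \<zero> \<longrightarrow>
      (\<exists>e \<in> boolean_center A. e \<in> principal_filter A x \<and> rl_neg A e \<in> principal_filter A y)"
    and "finite I" "\<And>i. i \<in> I \<Longrightarrow> x i \<in> carrier A"
    and "b \<in> boolean_center A" "b \<in> principal_filter A (finprod A x I)"
  shows "\<exists>e. (\<forall>i \<in> I. e i \<in> boolean_center A) \<and> finmeet A e I = b \<and>
    (\<forall>i \<in> I. \<forall>j \<in> I. i \<noteq> j \<longrightarrow> e i \<curlyvee> e j = \<one>) \<and> (\<forall>i \<in> I. e i \<in> principal_filter A (x i))"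
  using assms(2-)
proof (induction I arbitrary: b rule: finite_induct)
  case empty
  then have "b = \<one>" by (auto simp: principal_filter_def one_le_iff)
  then show ?case by simp
next
  case (insert a I)
  let ?p = "finprod A x I"
  have c: "x a \<in> carrier A" "?p \<in> carrier A"
    using insert.prems(1) by (auto intro!: finprod_closed)
  have "finprod A x (insert a I) = x a \<otimes> ?p"
    using insert.hyps insert.prems(1) by (intro finprod_insert) auto
  then obtain n :: nat where "x a [^] n \<otimes> ?p [^] n \<preceq> b"
    using insert.prems(3) c by (auto simp: principal_filter_def nat_pow_distrib)
  then obtain g h where gh: "g \<in> boolean_center A" "h \<in> boolean_center A"
    "g \<in> principal_filter A (x a [^] n)" "h \<in> principal_filter A (?p [^] n)"
    "g \<curlywedge> h = b" "g \<curlyvee> h = \<one>"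
    using splitting_relative[OF split insert.prems(2)] c by (metis nat_pow_closed)
  have ga: "g \<in> principal_filter A (x a)" and hp: "h \<in> principal_filter A ?p"
    using gh c principal_filter_pow by blast+
  obtain f where f: "\<forall>i \<in> I. f i \<in> boolean_center A" "finmeet A f I = h"
    "\<forall>i \<in> I. \<forall>j \<in> I. i \<noteq> j \<longrightarrow> f i \<curlyvee> f j = \<one>" "\<forall>i \<in> I. f i \<in> principal_filter A (x i)"
    using insert.IH[OF _ gh(2) hp] insert.prems(1) by auto
  have carr: "g \<in> carrier A" "h \<in> carrier A" "\<And>i. i \<in> I \<Longrightarrow> f i \<in> carrier A"
    using gh f by (simp_all add: boolean_center_iff)
  let ?e = "f(a := g)"
  have neq: "i \<noteq> a" if "i \<in> I" for i using that insert.hyps by blast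
  have cop: "g \<curlyvee> f i = \<one>" if "i \<in> I" for i
  proof (rule coprime_mono[OF gh(6)])
    show "h \<preceq> f i" using finmeet_le[of I i f] insert.hyps that carr f(2) by simp
  qed (use carr that in auto)
  have "finmeet A ?e I = finmeet A f I"
    using neq carr by (intro finmeet_cong) auto
  then have "finmeet A ?e (insert a I) = b"
    using insert.hyps carr neq f(2) gh(5) by (subst finmeet_insert) auto
  moreover have "\<forall>i \<in> insert a I. ?e i \<in> boolean_center A" using f gh by simp
  moreover have "\<forall>i \<in> insert a I. ?e i \<in> principal_filter A (x i)" using f ga by simp
  moreover have "\<forall>i \<in> insert a I. \<forall>j \<in> insert a I. i \<noteq> j \<longrightarrow> ?e i \<curlyvee> ?e j = \<one>"
    using f(3) cop carr neq by (auto simp: join_comm[of _ g])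
  ultimately show ?case by blast
qed

lemma boolean_zero: "\<zero> \<in> boolean_center A"
  using zero_least[OF one_closed] one_greatest[OF zero_closed]
  by (auto simp: boolean_center_def rl_le_def le_iff_join[OF zero_closed one_closed, symmetric]
      intro!: bexI[of _ \<one>])

end

section \<open>Characterizations of Boolean lifting\<close>

theorem proposition4p7:
  fixes A :: "('a, 'm) rlattice_scheme" (structure)
  assumes "residuated_lattice A"
  shows
    "(BLP A
      \<longleftrightarrow>
      (\<forall>x \<in> carrier A. \<exists>e \<in> boolean_center A.
        e \<in> principal_filter A x \<and> rl_neg A e \<in> principal_filter A (rl_neg A x)))
    \<and>
     (BLP A
      \<longleftrightarrow>
      (\<forall>x \<in> carrier A. \<forall>y \<in> carrier A. x \<otimes> y = \<zero> \<longrightarrow>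
        (\<exists>e \<in> boolean_center A.
          e \<in> principal_filter A x \<and> rl_neg A e \<in> principal_filter A y)))
    \<and>
     (BLP A
      \<longleftrightarrow>
      (\<forall>n::nat. n \<ge> 2 \<longrightarrow>
        (\<forall>x :: nat \<Rightarrow> 'a. (\<forall>i \<in> {1..n}. x i \<in> carrier A) \<longrightarrow> finprod A x {1..n} = \<zero> \<longrightarrow>
          (\<exists>e :: nat \<Rightarrow> 'a. (\<forall>i \<in> {1..n}. e i \<in> boolean_center A) \<and>
            finmeet A e {1..n} = \<zero> \<and>
            (\<forall>i \<in> {1..n}. \<forall>j \<in> {1..n}. i \<noteq> j \<longrightarrow> e i \<curlyvee> e j = \<one>) \<and>
            (\<forall>i \<in> {1..n}. e i \<in> principal_filter A (x i))))))"
proof -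
  interpret residuated_lattice A by (rule assms)
  let ?unary = "\<forall>x \<in> carrier A. \<exists>e \<in> boolean_center A.
    e \<in> principal_filter A x \<and> rl_neg A e \<in> principal_filter A (rl_neg A x)"
  let ?binary = "\<forall>x \<in> carrier A. \<forall>y \<in> carrier A. x \<otimes> y = \<zero> \<longrightarrow>
    (\<exists>e \<in> boolean_center A. e \<in> principal_filter A x \<and> rl_neg A e \<in> principal_filter A y)"
  let ?nary = "\<forall>n::nat. n \<ge> 2 \<longrightarrow>
    (\<forall>x :: nat \<Rightarrow> 'a. (\<forall>i \<in> {1..n}. x i \<in> carrier A) \<longrightarrow> finprod A x {1..n} = \<zero> \<longrightarrow>
      (\<exists>e :: nat \<Rightarrow> 'a. (\<forall>i \<in> {1..n}. e i \<in> boolean_center A) \<and>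
        finmeet A e {1..n} = \<zero> \<and>
        (\<forall>i \<in> {1..n}. \<forall>j \<in> {1..n}. i \<noteq> j \<longrightarrow> e i \<curlyvee> e j = \<one>) \<and>
        (\<forall>i \<in> {1..n}. e i \<in> principal_filter A (x i))))"
  have 13: "BLP A \<Longrightarrow> ?binary" using BLP_imp_splitting by blast
  have 32: "?binary \<Longrightarrow> ?unary" using mult_neg neg_closed by blast
  have 21: "?unary \<Longrightarrow> BLP A" using unary_splitting_imp_BLP by blast
  have 34: ?nary if bin: ?binary
  proof (intro allI impI)
    fix n :: nat and x :: "nat \<Rightarrow> 'a"
    assume x: "\<forall>i \<in> {1..n}. x i \<in> carrier A" "finprod A x {1..n} = \<zero>"
    show "\<exists>e :: nat \<Rightarrow> 'a. (\<forall>i \<in> {1..n}. e i \<in> boolean_center A) \<and>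
        finmeet A e {1..n} = \<zero> \<and>
        (\<forall>i \<in> {1..n}. \<forall>j \<in> {1..n}. i \<noteq> j \<longrightarrow> e i \<curlyvee> e j = \<one>) \<and>
        (\<forall>i \<in> {1..n}. e i \<in> principal_filter A (x i))"
    proof (rule splitting_finite)
      show "\<zero> \<in> principal_filter A (finprod A x {1..n})"
        unfolding x(2) by (rule principal_filter_self) simp
    qed (use bin x boolean_zero in auto)
  qed
  have 43: ?binary if nary: ?nary
  proof (intro ballI impI)
    fix x y assume c: "x \<in> carrier A" "y \<in> carrier A" and xy: "x \<otimes> y = \<zero>"
    let ?x = "\<lambda>i::nat. if i = 1 then x else y"
    have two: "{1..2::nat} = {1, 2}" by auto
    have prod: "finprod A ?x {1..2} = \<zero>" unfolding two using c xy by simp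
    have carr: "\<forall>i \<in> {1..2}. ?x i \<in> carrier A" using c by simp
    obtain e :: "nat \<Rightarrow> 'a" where e: "\<forall>i \<in> {1..2}. e i \<in> boolean_center A"
      "finmeet A e {1..2} = \<zero>" "\<forall>i \<in> {1..2}. \<forall>j \<in> {1..2}. i \<noteq> j \<longrightarrow> e i \<curlyvee> e j = \<one>"
      "\<forall>i \<in> {1..2}. e i \<in> principal_filter A (?x i)"
      using nary[THEN spec, of 2, THEN mp, OF order_refl, THEN spec, of ?x, THEN mp, OF carr,
          THEN mp, OF prod] by blast
    have ec: "e 1 \<in> carrier A" "e 2 \<in> carrier A" using e(1) by (simp_all add: boolean_center_iff)
    have cop: "e 1 \<curlyvee> e 2 = \<one>" using e(3) by simp
    have "e 1 \<curlywedge> (e 2 \<curlywedge> \<one>) = \<zero>"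
      using e(2) ec finmeet_insert[of "{2}" 1 e] finmeet_insert[of "{}" 2 e]
      unfolding two by simp
    then have "e 1 \<curlywedge> e 2 = \<zero>" using one_greatest[OF ec(2)] by (simp add: rl_le_def)
    then have "e 2 = rl_neg A (e 1)"
      using cop ec by (simp add: complement_eq_neg flip: coprime_meet)
    then have "rl_neg A (e 1) \<in> principal_filter A y" "e 1 \<in> principal_filter A x"
      using e(4) by (auto dest: bspec[of _ _ 1] bspec[of _ _ 2])
    moreover have "e 1 \<in> boolean_center A" using e(1) by simp
    ultimately show "\<exists>e \<in> boolean_center A.
        e \<in> principal_filter A x \<and> rl_neg A e \<in> principal_filter A y"
      by blast
  qed
  have "BLP A \<longleftrightarrow> ?unary" "BLP A \<longleftrightarrow> ?binary" using 13 32 21 by blast+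
  moreover have "BLP A \<longleftrightarrow> ?nary"
  proof
    assume "BLP A"
    then show ?nary by (rule 34[OF 13])
  next
    assume ?nary
    then show "BLP A" by (rule 21[OF 32[OF 43]])
  qed
  ultimately show ?thesis by (intro conjI)
qed

end
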